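(* Let $Z,Y$ be real Banach spaces with $Y$ reflexive and let $b:Z\times Y\to\mathbb{R}$ be a continuous bilinear form. Let $(X_n)_{n\in\mathbb{N}}$ and $(Y_n)_{n\in\mathbb{N}}$ be sequences of finite dimensional subspaces of $Z$ and $Y$, respectively, such that $\dim X_n=\dim Y_n$ for every $n\in\mathbb{N}$. Assume that there exists $\beta>0$ such that $$\sup_{y\in Y_n,\ \|y\|_Y=1} b(x,y)\ge\beta\|x\|_Z\quad\text{for all }x\in X_n\text{ and all }n\in\mathbb{N}.$$ Let $X_\infty=\lim_{n\to\infty}X_n$. Assume that there exists a closed subspace $X$ of $X_\infty$ such that, for every $y\in Y$, $$\big(b(x,y)=0\ \text{for all }x\in X\big)\ \Longrightarrow\ y=0 .$$ Then $X=X_\infty$. Moreover, for any $L\in Y'$ there exists one and only one $\widehat{x}\in X$ such that $b(\widehat{x},y)=L(y)$ for all $y\in Y$. In addition, if $x_n$ denotes the (unique) element of $X_n$ such that $b(x_n,y)=L(y)$ for all $y\in Y_n$, then $x_n$ converges to $\widehat{x}$ in $Z$ as $n\to\infty$. Finally, $Y=\mathop{\mathrm{w\text{-}lim}}_{n\to\infty}Y_n$.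
   Context: For a sequence $(X_n)_{n\in\mathbb{N}}$ of subspaces of a Banach space $Z$: $\lim_{n\to\infty}X_n$ is the set of all $x\in Z$ for which there exist $x_n\in X_n$ ($n\in\mathbb{N}$) with $x_n\to x$ in norm; $\mathop{\mathrm{w\text{-}lim}}_{n\to\infty}X_n$ is the set of all $x\in Z$ for which there exist $x_n\in X_n$ ($n\in\mathbb{N}$) with $x_n\rightharpoonup x$ weakly in $Z$. $Y'$ denotes the topological dual of $Y$. A supremum over the empty set (case $Y_n=\{0\}$) is read as $0$. *)

theory Defs
  imports "HOL-Analysis.Analysis"
begin

definition finite_dim_subspace :: "'a::real_vector set \<Rightarrow> bool" where
  "finite_dim_subspace S \<longleftrightarrow> subspace S \<and> (\<exists>B. finite B \<and> S = span B)"

definition bidual_embedding :: "'a::real_normed_vector \<Rightarrow> ('a \<Rightarrow>\<^sub>L real) \<Rightarrow>\<^sub>L real" where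
  "bidual_embedding x = Blinfun (\<lambda>f. blinfun_apply f x)"

lemma bidual_embedding_apply:
  "blinfun_apply (bidual_embedding x) f = blinfun_apply f x"
  unfolding bidual_embedding_def
  by (subst bounded_linear_Blinfun_apply) (auto intro: bounded_linear_intros)

definition reflexive_space :: "'a::real_normed_vector itself \<Rightarrow> bool" where
  "reflexive_space (_ :: 'a itself) \<longleftrightarrow>
     surj (bidual_embedding :: 'a \<Rightarrow> ('a \<Rightarrow>\<^sub>L real) \<Rightarrow>\<^sub>L real)"

definition weakly_converges :: "(nat \<Rightarrow> 'a::real_normed_vector) \<Rightarrow> 'a \<Rightarrow> bool" where
  "weakly_converges u x \<longleftrightarrow>
     (\<forall>f :: 'a \<Rightarrow>\<^sub>L real. (\<lambda>n. blinfun_apply f (u n)) \<longlonglongrightarrow> blinfun_apply f x)"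

definition strong_lim :: "(nat \<Rightarrow> 'a::real_normed_vector set) \<Rightarrow> 'a set" where
  "strong_lim S = {x. \<exists>u. (\<forall>n. u n \<in> S n) \<and> u \<longlonglongrightarrow> x}"

definition weak_lim :: "(nat \<Rightarrow> 'a::real_normed_vector set) \<Rightarrow> 'a set" where
  "weak_lim S = {x. \<exists>u. (\<forall>n. u n \<in> S n) \<and> weakly_converges u x}"

(* The empty case is separated because Sup {} is not fixed to be 0 on the reals. *)
definition unit_sup :: "'a::real_normed_vector set \<Rightarrow> ('a \<Rightarrow> real) \<Rightarrow> real" where
  "unit_sup S f =
     (if {y \<in> S. norm y = 1} = {} then 0 else (SUP y \<in> {y \<in> S. norm y = 1}. f y))"

end

theory Submission
  imports Defs
begin

text \<open>
  The discrete inf-sup bounds pass to the limit: the operator \<open>x \<mapsto> b x\<close> is bounded below on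
  \<open>strong_lim Xs\<close>, so it is injective there and maps \<open>X\<close> onto a closed subspace of the dual of
  \<open>Y\<close>. A functional vanishing on this image is, by reflexivity, evaluation at some \<open>y\<close>, hence
  zero by hypothesis; so already \<open>X\<close> is mapped onto the dual. Comparing the discrete solutions
  with any approximation of the exact one gives their convergence (Cea's lemma). For the weak
  limit, let \<open>y\<^sub>n\<close> solve the transposed discrete problem with datum \<open>b \<cdot> y\<close>: then
  \<open>L y\<^sub>n = b x\<^sub>n y\<^sub>n = b x\<^sub>n y \<longrightarrow> b x y = L y\<close>, with \<open>x\<^sub>n \<longrightarrow> x\<close> the solutions for \<open>L\<close>.
\<close>

section \<open>The Hahn-Banach theorem\<close>

definition sublinear :: "('a::real_vector \<Rightarrow> real) \<Rightarrow> bool" where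
  "sublinear p \<longleftrightarrow> (\<forall>x y. p (x + y) \<le> p x + p y) \<and> (\<forall>t x. t > 0 \<longrightarrow> p (t *\<^sub>R x) = t * p x)"

text \<open>Applying the scaling inequality with \<open>inverse t\<close> at
  \<open>t *\<^sub>R x\<close> yields its converse, so one direction suffices.\<close>

lemma sublinearI:
  assumes "\<And>x y. p (x + y) \<le> p x + p y" and "\<And>t x. t > 0 \<Longrightarrow> p (t *\<^sub>R x) \<le> t * p x"
  shows "sublinear p"
proof -
  have "p (t *\<^sub>R x) = t * p x" if "t > 0" for t x
  proof (rule antisym)
    have "p x \<le> inverse t * p (t *\<^sub>R x)"
      using assms(2)[of "inverse t" "t *\<^sub>R x"] that by simp
    then show "t * p x \<le> p (t *\<^sub>R x)"
      using that by (simp add: field_simps)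
  qed (use assms(2) that in blast)
  then show ?thesis
    using assms(1) by (auto simp: sublinear_def)
qed

lemma sublinear_add: "sublinear p \<Longrightarrow> p (x + y) \<le> p x + p y"
  and sublinear_scaleR: "sublinear p \<Longrightarrow> t > 0 \<Longrightarrow> p (t *\<^sub>R x) = t * p x"
  by (auto simp: sublinear_def)

lemma sublinear_zero: "sublinear p \<Longrightarrow> p 0 = 0"
  using sublinear_scaleR[of p 2 0] by simp

lemma sublinear_minus_ge: "sublinear p \<Longrightarrow> - p (- x) \<le> p x"
  using sublinear_add[of p x "- x"] sublinear_zero[of p] by simp

text \<open>The greatest sublinear functional below \<open>p\<close> with value at most \<open>- p y\<close> at \<open>- y\<close>.\<close>

definition tilt :: "('a::real_vector \<Rightarrow> real) \<Rightarrow> 'a \<Rightarrow> 'a \<Rightarrow> real" where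
  "tilt p y x = (INF t\<in>{0..}. p (x + t *\<^sub>R y) - t * p y)"

context
  fixes p :: "'a::real_vector \<Rightarrow> real" and y :: 'a
  assumes p: "sublinear p"
begin

lemma tilt_le:
  assumes "t \<ge> 0"
  shows "tilt p y x \<le> p (x + t *\<^sub>R y) - t * p y"
proof -
  \<comment> \<open>A real \<open>INF\<close> is a lower bound only when the family is bounded
    below. The bound \<open>- p (- x)\<close>, independent of \<open>s\<close>, comes from
    \<open>s * p y = p (s *\<^sub>R y)\<close> and subadditivity; \<open>s = 0\<close> is separate
    because homogeneity is stated for positive factors.\<close>
  have "- p (- x) \<le> p (x + s *\<^sub>R y) - s * p y" if "s \<ge> 0" for s
  proof (cases "s = 0")
    case True
    then show ?thesis
      using sublinear_minus_ge[OF p, of x] by simp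
  next
    case False
    then show ?thesis
      using sublinear_add[OF p, of "x + s *\<^sub>R y" "- x"] sublinear_scaleR[OF p, of s y] that
      by simp
  qed
  then have "bdd_below ((\<lambda>t. p (x + t *\<^sub>R y) - t * p y) ` {0..})"
    by (intro bdd_belowI2[where m = "- p (- x)"]) auto
  then show ?thesis
    unfolding tilt_def by (rule cINF_lower) (use assms in auto)
qed

lemma tilt_greatest:
  assumes "\<And>t. t \<ge> 0 \<Longrightarrow> c \<le> p (x + t *\<^sub>R y) - t * p y"
  shows "c \<le> tilt p y x"
  unfolding tilt_def by (rule cINF_greatest) (use assms in auto)

lemma tilt_le_self: "tilt p y x \<le> p x"
  using tilt_le[of 0 x] by simp

lemma tilt_minus_le: "tilt p y (- y) \<le> - p y"
  using tilt_le[of 1 "- y"] sublinear_zero[OF p] by simp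

text \<open>Parameters \<open>s\<close> and \<open>t\<close> for the two summands combine to the
  parameter \<open>s + t\<close> for their sum, and scaling by \<open>t\<close> turns the parameter
  \<open>s\<close> into \<open>t * s\<close>. Infima are then taken over one parameter at a
  time.\<close>

lemma sublinear_tilt: "sublinear (tilt p y)"
proof (rule sublinearI)
  fix x z
  have "tilt p y (x + z) - (p (x + s *\<^sub>R y) - s * p y) \<le> p (z + t *\<^sub>R y) - t * p y"
    if "s \<ge> 0" "t \<ge> 0" for s t
  proof -
    have "tilt p y (x + z) \<le> p ((x + s *\<^sub>R y) + (z + t *\<^sub>R y)) - (s + t) * p y"
      using tilt_le[of "s + t" "x + z"] that by (simp add: algebra_simps)
    then show ?thesis
      using sublinear_add[OF p, of "x + s *\<^sub>R y" "z + t *\<^sub>R y"] by (simp add: algebra_simps)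
  qed
  then have "tilt p y (x + z) - (p (x + s *\<^sub>R y) - s * p y) \<le> tilt p y z" if "s \<ge> 0" for s
    using that by (intro tilt_greatest) auto
  then have "tilt p y (x + z) - tilt p y z \<le> tilt p y x"
    by (intro tilt_greatest) (simp add: algebra_simps)
  then show "tilt p y (x + z) \<le> tilt p y x + tilt p y z"
    by simp
next
  fix t :: real and x
  assume t: "t > 0"
  have "inverse t * tilt p y (t *\<^sub>R x) \<le> p (x + s *\<^sub>R y) - s * p y" if "s \<ge> 0" for s
  proof -
    have "tilt p y (t *\<^sub>R x) \<le> p (t *\<^sub>R (x + s *\<^sub>R y)) - (t * s) * p y"
      using tilt_le[of "t * s" "t *\<^sub>R x"] that t by (simp add: algebra_simps)
    then show ?thesis
      using sublinear_scaleR[OF p t, of "x + s *\<^sub>R y"] t by (simp add: field_simps)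
  qed
  then have "inverse t * tilt p y (t *\<^sub>R x) \<le> tilt p y x"
    by (rule tilt_greatest)
  then show "tilt p y (t *\<^sub>R x) \<le> t * tilt p y x"
    using t by (simp add: field_simps)
qed

end

text \<open>Subadditivity survives because members \<open>q\<close> and \<open>r\<close>, nearly
  optimal at \<open>x\<close> and at \<open>y\<close>, can both be replaced by the smaller of the
  two.\<close>

lemma sublinear_INF_chain:
  fixes C :: "('a::real_vector \<Rightarrow> real) set"
  assumes "C \<noteq> {}" and sub: "\<And>q. q \<in> C \<Longrightarrow> sublinear q"
    and chain: "\<And>q r. q \<in> C \<Longrightarrow> r \<in> C \<Longrightarrow> q \<le> r \<or> r \<le> q"
    and bdd: "\<And>x. bdd_below ((\<lambda>q. q x) ` C)"
  shows "sublinear (\<lambda>x. INF q\<in>C. q x)"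
proof (rule sublinearI)
  have low: "(INF q\<in>C. q x) \<le> q x" if "q \<in> C" for q x
    using bdd that by (rule cINF_lower)
  fix x y
  have "(INF q\<in>C. q (x + y)) - q x \<le> r y" if qr: "q \<in> C" "r \<in> C" for q r
  proof -
    obtain s where s: "s \<in> C" "s \<le> q" "s \<le> r"
      using chain[OF qr] qr by auto
    have "(INF q\<in>C. q (x + y)) \<le> s x + s y"
      using low[OF s(1), of "x + y"] sublinear_add[OF sub[OF s(1)], of x y] by simp
    also have "\<dots> \<le> q x + r y"
      using s by (intro add_mono) (auto simp: le_fun_def)
    finally show ?thesis
      by simp
  qed
  then have "(INF q\<in>C. q (x + y)) - q x \<le> (INF q\<in>C. q y)" if "q \<in> C" for q
    using that \<open>C \<noteq> {}\<close> by (intro cINF_greatest) auto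
  then have "(INF q\<in>C. q (x + y)) - (INF q\<in>C. q y) \<le> (INF q\<in>C. q x)"
    using \<open>C \<noteq> {}\<close> by (intro cINF_greatest) (auto simp: algebra_simps)
  then show "(INF q\<in>C. q (x + y)) \<le> (INF q\<in>C. q x) + (INF q\<in>C. q y)"
    by simp
next
  fix t :: real and x
  assume t: "t > 0"
  have "inverse t * (INF q\<in>C. q (t *\<^sub>R x)) \<le> q x" if "q \<in> C" for q
  proof -
    have "(INF q\<in>C. q (t *\<^sub>R x)) \<le> t * q x"
      using cINF_lower[OF bdd that, of "t *\<^sub>R x"] sublinear_scaleR[OF sub[OF that] t] by simp
    then show ?thesis
      using t by (simp add: field_simps)
  qed
  then have "inverse t * (INF q\<in>C. q (t *\<^sub>R x)) \<le> (INF q\<in>C. q x)"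
    using \<open>C \<noteq> {}\<close> by (intro cINF_greatest) auto
  then show "(INF q\<in>C. q (t *\<^sub>R x)) \<le> t * (INF q\<in>C. q x)"
    using t by (simp add: field_simps)
qed

text \<open>Tilting stays sublinear and below \<open>q\<close>, so minimality forces
  \<open>tilt q y = q\<close>. The parameter value 1 in the infimum then gives superadditivity,
  hence additivity, and oddness extends homogeneity to negative factors.\<close>

lemma minimal_sublinear_linear:
  assumes q: "sublinear q" and minimal: "\<And>r. sublinear r \<Longrightarrow> r \<le> q \<Longrightarrow> r = q"
  shows "linear q"
proof -
  have "tilt q y = q" for y
    by (rule minimal) (auto simp: le_fun_def sublinear_tilt[OF q] tilt_le_self[OF q])
  then have "q x \<le> q (x + y) - q y" for x y
    using tilt_le[OF q, of 1 y x] by simp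
  then have add: "q (x + y) = q x + q y" for x y
    using sublinear_add[OF q, of x y] by (smt (verit))
  have neg: "q (- x) = - q x" for x
    using add[of x "- x"] sublinear_zero[OF q] by simp
  have "q (t *\<^sub>R x) = t *\<^sub>R q x" for t x
  proof (cases t "0::real" rule: linorder_cases)
    case less
    then show ?thesis
      using sublinear_scaleR[OF q, of "- t" x] neg[of "t *\<^sub>R x"] by simp
  qed (use sublinear_zero[OF q] sublinear_scaleR[OF q] in auto)
  with add show ?thesis
    by (intro linearI)
qed

text \<open>Zorn's lemma gives a minimal sublinear functional below \<open>p\<close>, and minimal
  ones are linear. No subspace appears in this form: a prescribed behaviour is imposed by the choice
  of \<open>p\<close>, for instance by tilting it first.\<close>

theorem Hahn_Banach_sublinear:
  fixes p :: "'a::real_vector \<Rightarrow> real"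
  assumes p: "sublinear p"
  shows "\<exists>f. linear f \<and> f \<le> p"
proof -
  define A where "A = {q. sublinear q \<and> q \<le> p}"
  have "\<exists>m\<in>A. \<forall>q\<in>A. m \<ge> q \<longrightarrow> q = m"
  \<comment> \<open>The order is reversed, so that maximal elements are the minimal functionals and
    upper bounds of chains are pointwise infima.\<close>
  proof (rule predicate_Zorn[where P = "\<lambda>q r. q \<ge> r"])
    show "partial_order_on A (relation_of (\<lambda>q r. q \<ge> r) A)"
      by (rule partial_order_on_relation_ofI) auto
  next
    fix C
    assume C: "C \<in> Chains (relation_of (\<lambda>q r. q \<ge> r) A)"
    then have CA: "C \<subseteq> A" and chain: "\<And>q r. q \<in> C \<Longrightarrow> r \<in> C \<Longrightarrow> q \<le> r \<or> r \<le> q"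
      by (auto simp: Chains_def relation_of_def)
    show "\<exists>u\<in>A. \<forall>q\<in>C. q \<ge> u"
    proof (cases "C = {}")
      case True
      then show ?thesis
        using p by (auto simp: A_def)
    next
      case False
      \<comment> \<open>Here \<open>q x \<ge> - q (- x) \<ge> - p (- x)\<close>, a lower bound
        common to the whole chain.\<close>
      have "- p (- x) \<le> q x" if "q \<in> C" for q x
        using sublinear_minus_ge[of q x] that CA
        by (auto simp: A_def le_fun_def dest!: subsetD) (smt (verit))
      then have bdd: "bdd_below ((\<lambda>q. q x) ` C)" for x
        by (intro bdd_belowI2) auto
      let ?u = "\<lambda>x. INF q\<in>C. q x"
      have low: "?u \<le> q" if "q \<in> C" for q
        using cINF_lower[OF bdd that] by (auto simp: le_fun_def)
      have "sublinear ?u"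
        using False CA chain bdd by (intro sublinear_INF_chain) (auto simp: A_def)
      moreover obtain q where q: "q \<in> C"
        using False by blast
      have "?u \<le> p"
        using order_trans[OF low[OF q], of p] q CA by (auto simp: A_def)
      ultimately show ?thesis
        using low by (auto simp: A_def)
    qed
  qed
  then obtain m where m: "sublinear m" "m \<le> p" and min: "\<And>q. q \<in> A \<Longrightarrow> q \<le> m \<Longrightarrow> q = m"
    by (auto simp: A_def)
  \<comment> \<open>A sublinear functional below \<open>m\<close> is also below \<open>p\<close>, so
    minimality within \<open>A\<close> is minimality among all sublinear functionals.\<close>
  have "linear m"
    using m by (intro minimal_sublinear_linear min) (auto simp: A_def intro: order_trans)
  with m show ?thesis
    by blast
qed

section \<open>Separation of a point from a closed subspace\<close>

lemma infdist_greatest: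
  assumes "S \<noteq> {}" and "\<And>a. a \<in> S \<Longrightarrow> c \<le> dist x a"
  shows "c \<le> infdist x S"
  using assms by (auto simp: infdist_def intro: cINF_greatest)

text \<open>Sums and multiples of competitors in \<open>M\<close> are again competitors in
  \<open>M\<close>.\<close>

lemma sublinear_infdist_subspace:
  fixes M :: "'a::real_normed_vector set"
  assumes M: "subspace M"
  shows "sublinear (\<lambda>x. infdist x M)"
proof -
  have "M \<noteq> {}"
    using subspace_0[OF M] by blast
  note greatest = infdist_greatest[OF this]
  show ?thesis
  proof (rule sublinearI)
    fix x y
    have "infdist (x + y) M - dist x a \<le> dist y c" if "a \<in> M" "c \<in> M" for a c
      using infdist_le[OF subspace_add[OF M that], of "x + y"] dist_triangle_add[of x y a c] by simp
    then have "infdist (x + y) M - dist x a \<le> infdist y M" if "a \<in> M" for a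
      using that by (intro greatest) auto
    then have "infdist (x + y) M - infdist y M \<le> infdist x M"
      by (intro greatest) (simp add: algebra_simps)
    then show "infdist (x + y) M \<le> infdist x M + infdist y M"
      by simp
  next
    fix t :: real and x
    assume t: "t > 0"
    have "inverse t * infdist (t *\<^sub>R x) M \<le> dist x a" if "a \<in> M" for a
      using infdist_le[OF subspace_scale[OF M that, of t], of "t *\<^sub>R x"] t
      by (simp add: dist_norm flip: scaleR_diff_right) (simp add: field_simps)
    then have "inverse t * infdist (t *\<^sub>R x) M \<le> infdist x M"
      by (rule greatest)
    then show "infdist (t *\<^sub>R x) M \<le> t * infdist x M"
      using t by (simp add: field_simps)
  qed
qed

text \<open>A linear \<open>g\<close> below the distance to \<open>M\<close> is bounded by the norm
  and vanishes on \<open>M\<close>. Tilting the distance at \<open>x0\<close> beforehand also forces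
  \<open>g (- x0)\<close> to be at most minus the distance of \<open>x0\<close>, which is negative
  because \<open>M\<close> is closed.\<close>

theorem closed_subspace_annihilator:
  fixes M :: "'a::real_normed_vector set"
  assumes M: "subspace M" "closed M" and x0: "x0 \<notin> M"
  obtains f :: "'a \<Rightarrow>\<^sub>L real" where "\<And>x. x \<in> M \<Longrightarrow> f x = 0" "f x0 \<noteq> 0"
proof -
  let ?d = "\<lambda>x. infdist x M"
  have ne: "M \<noteq> {}"
    using subspace_0[OF M(1)] by blast
  note d = sublinear_infdist_subspace[OF M(1)]
  obtain g where g: "linear g" "g \<le> tilt ?d x0"
    using Hahn_Banach_sublinear[OF sublinear_tilt[OF d]] by blast
  have le: "g x \<le> ?d x" for x
    using g(2) tilt_le_self[OF d, of x0 x] by (auto simp: le_fun_def intro: order_trans)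
  have minus: "g (- x) = - g x" for x
    using g(1) by (rule linear_neg)
  have "?d x \<le> norm x" for x
    using infdist_le[OF subspace_0[OF M(1)], of x] by simp
  then have "\<bar>g x\<bar> \<le> norm x" for x
    using le[of x] le[of "- x"] minus[of x] by (smt (verit) norm_minus_cancel)
  then have bl: "bounded_linear g"
    using g(1) by (intro bounded_linear_intro[where K = 1]) (auto simp: linear_add linear_scale)
  have "g x = 0" if "x \<in> M" for x
    using le[of x] le[of "- x"] minus[of x] that subspace_neg[OF M(1) that] by simp
  moreover have "g x0 \<noteq> 0"
  proof -
    have "?d x0 > 0"
      using in_closed_iff_infdist_zero[OF M(2) ne, of x0] infdist_nonneg[of x0 M] x0 by linarith
    moreover have "g (- x0) \<le> - ?d x0"
      using g(2) tilt_minus_le[OF d, of x0] by (auto simp: le_fun_def intro: order_trans)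
    ultimately show ?thesis
      using minus[of x0] by linarith
  qed
  ultimately show ?thesis
    using that[of "Blinfun g"] bounded_linear_Blinfun_apply[OF bl] by simp
qed

text \<open>A nonzero functional on the dual annihilating \<open>M\<close> would, by reflexivity, be
  evaluation at some \<open>y\<close>; totality makes \<open>y = 0\<close>, a contradiction.\<close>

lemma reflexive_dual_subspace_eq_UNIV:
  fixes M :: "('a::real_normed_vector \<Rightarrow>\<^sub>L real) set"
  assumes "reflexive_space TYPE('a)" and "subspace M" "closed M"
    and total: "\<And>y. (\<forall>f\<in>M. blinfun_apply f y = 0) \<Longrightarrow> y = 0"
  shows "M = UNIV"
proof (rule ccontr)
  assume "M \<noteq> UNIV"
  then obtain f where "f \<notin> M"
    by blast
  then obtain F :: "('a \<Rightarrow>\<^sub>L real) \<Rightarrow>\<^sub>L real" where F: "\<And>g. g \<in> M \<Longrightarrow> F g = 0" "F f \<noteq> 0"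
    using closed_subspace_annihilator assms(2,3) by blast
  obtain y where "F = bidual_embedding y"
    using assms(1) unfolding reflexive_space_def by (metis surjD)
  with F total[of y] show False
    by (auto simp: bidual_embedding_apply)
qed

section \<open>Finite-dimensional pairings\<close>

text \<open>A vector of \<open>span C\<close> outside \<open>span B\<close> could be added to
  \<open>B\<close>, giving an independent set in \<open>span C\<close> with more than
  \<open>card C\<close> elements.\<close>

lemma independent_card_ge_span:
  assumes C: "finite C" and B: "independent B" "B \<subseteq> span C" and card: "card C \<le> card B"
  shows "span C \<subseteq> span B"
proof
  fix v
  assume v: "v \<in> span C"
  have fB: "finite B"
    using independent_span_bound[OF C B] by blast
  show "v \<in> span B"
  proof (rule ccontr)
    assume nv: "v \<notin> span B"
    then have "card (insert v B) \<le> card C"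
      using independent_span_bound[OF C, of "insert v B"] independent_insertI[OF nv B(1)] v B(2)
      by simp
    moreover have "v \<notin> B"
      using nv span_base by blast
    ultimately show False
      using card fB by simp
  qed
qed

lemma finite_dim_basis:
  assumes "finite_dim_subspace V"
  obtains B where "independent B" "finite B" "V = span B" "card B = dim V"
proof -
  obtain A where A: "finite A" "V = span A" and V: "subspace V"
    using assms by (auto simp: finite_dim_subspace_def)
  obtain B where B: "B \<subseteq> V" "independent B" "V \<subseteq> span B" "card B = dim V"
    using basis_exists by blast
  have "finite B"
    using independent_span_bound[OF A(1) B(2)] A B by auto
  moreover have "V = span B"
    using B V by (simp add: span_subspace)
  ultimately show ?thesis
    using B that by blast
qed

context
  fixes b :: "'a::real_vector \<Rightarrow> 'b::real_vector \<Rightarrow> real" and S :: "'a set" and T :: "'b set"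
  assumes b: "bilinear b"
    and fin: "finite_dim_subspace S" "finite_dim_subspace T"
    and dims: "dim S = dim T"
    and nondeg: "\<And>x. x \<in> S \<Longrightarrow> (\<forall>y\<in>T. b x y = 0) \<Longrightarrow> x = 0"
begin

text \<open>The map \<open>\<Phi>\<close> stores the values of \<open>b x\<close> on a basis
  \<open>C\<close> of \<open>T\<close> as coefficients of a vector of \<open>T\<close>.
  Nondegeneracy makes it injective on \<open>S\<close>, equality of dimensions makes it onto
  \<open>T\<close>, and a preimage of the vector with coefficients \<open>g c\<close> represents
  \<open>g\<close>.\<close>

lemma pairing_represents:
  assumes g: "linear g"
  shows "\<exists>x\<in>S. \<forall>y\<in>T. b x y = g y"
proof -
  obtain B where B: "independent B" "finite B" "S = span B" "card B = dim S"
    using finite_dim_basis[OF fin(1)] .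
  obtain C where C: "independent C" "finite C" "T = span C" "card C = dim T"
    using finite_dim_basis[OF fin(2)] .
  have lin: "linear (\<lambda>x. b x y)" "linear (b x)" for x y
    using b by (auto simp: bilinear_def)
  have coords: "\<forall>c\<in>C. u c = v c" if "(\<Sum>c\<in>C. u c *\<^sub>R c) = (\<Sum>c\<in>C. v c *\<^sub>R c)" for u v
  proof -
    have "(\<Sum>c\<in>C. (u c - v c) *\<^sub>R c) = 0"
      using that by (simp add: scaleR_left_diff_distrib sum_subtractf)
    then show ?thesis
      using independentD[OF C(1,2), where u = "\<lambda>c. u c - v c"] by auto
  qed
  have extend: "\<forall>y\<in>T. b x y = h y" if "linear h" "\<forall>c\<in>C. b x c = h c" for x h
    using linear_eq_on[OF lin(2) that(1)] that(2) C(3) by blast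
  define \<Phi> where "\<Phi> x = (\<Sum>c\<in>C. b x c *\<^sub>R c)" for x
  have \<Phi>: "linear \<Phi>"
    by (rule linearI)
       (auto simp: \<Phi>_def linear_add[OF lin(1)] linear_scale[OF lin(1)] scaleR_left_distrib
          sum.distrib scaleR_sum_right)
  have inj: "inj_on \<Phi> (span B)"
  proof (subst linear_injective_on_subspace_0[OF \<Phi> subspace_span], intro ballI impI)
    fix x
    assume x: "x \<in> span B" "\<Phi> x = 0"
    then have "\<forall>c\<in>C. b x c = 0"
      using coords[of "b x" "\<lambda>_. 0"] by (simp add: \<Phi>_def)
    then have "\<forall>y\<in>T. b x y = 0"
      by (intro extend linear_zero) auto
    with x B(3) nondeg show "x = 0"
      by blast
  qed
  have comb: "(\<Sum>c\<in>C. u c *\<^sub>R c) \<in> span C" for u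
    by (intro span_sum span_scale span_base)
  then have "\<Phi> ` B \<subseteq> span C"
    by (auto simp: \<Phi>_def)
  moreover have "independent (\<Phi> ` B)"
    using linear_independent_injective_image[OF \<Phi> B(1) inj] .
  moreover have "card (\<Phi> ` B) = dim (span C)"
    using inj B(4) C(3,4) dims by (simp add: card_image inj_on_subset span_superset)
  ultimately have "span C \<subseteq> span (\<Phi> ` B)"
    using C(1,2) by (intro independent_card_ge_span) (simp_all add: dim_eq_card_independent)
  then have "(\<Sum>c\<in>C. g c *\<^sub>R c) \<in> \<Phi> ` span B"
    using comb by (auto simp: linear_span_image[OF \<Phi>])
  then obtain x where "x \<in> S" "(\<Sum>c\<in>C. b x c *\<^sub>R c) = (\<Sum>c\<in>C. g c *\<^sub>R c)"
    using B(3) by (auto simp: \<Phi>_def)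
  with coords extend[OF g] show ?thesis
    by blast
qed

text \<open>If \<open>y\<close> were nonzero, a linear \<open>g\<close> with \<open>g y = 1\<close>
  would be represented by some \<open>x\<close> in \<open>S\<close>, so that
  \<open>b x y = 1\<close>. This lets the representation result be applied to the transposed
  pairing.\<close>

lemma pairing_nondegenerate_right:
  assumes y: "y \<in> T" "\<forall>x\<in>S. b x y = 0"
  shows "y = 0"
proof (rule ccontr)
  assume "y \<noteq> 0"
  then obtain g :: "'b \<Rightarrow> real" where "linear g" "g y = 1"
    using linear_independent_extend[of "{y}" "\<lambda>_. 1"] by auto
  with pairing_represents[of g] y show False
    by fastforce
qed

end

section \<open>Limits of subspaces\<close>

text \<open>This replaces the choice of a sequence by a scalar limit, from which closedness of the
  limit is easily read off.\<close>

lemma strong_lim_iff_infdist: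
  assumes ne: "\<And>n. S n \<noteq> {}"
  shows "x \<in> strong_lim S \<longleftrightarrow> (\<lambda>n. infdist x (S n)) \<longlonglongrightarrow> 0"
proof
  assume "x \<in> strong_lim S"
  then obtain u where u: "\<And>n. u n \<in> S n" "u \<longlonglongrightarrow> x"
    by (auto simp: strong_lim_def)
  have "(\<lambda>n. dist x (u n)) \<longlonglongrightarrow> 0"
    using tendsto_dist[OF tendsto_const u(2), of x] by simp
  then show "(\<lambda>n. infdist x (S n)) \<longlonglongrightarrow> 0"
    by (rule Lim_null_comparison[rotated]) (simp add: infdist_nonneg infdist_le u(1))
next
  assume lim: "(\<lambda>n. infdist x (S n)) \<longlonglongrightarrow> 0"
  \<comment> \<open>The distance need not be attained in \<open>S n\<close>; a positive slack
    tending to zero gives near-minimisers that still converge.\<close>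
  have "\<exists>a\<in>S n. dist x a < infdist x (S n) + inverse (real (Suc n))" for n
  proof (rule ccontr)
    assume "\<not> ?thesis"
    then have "infdist x (S n) + inverse (real (Suc n)) \<le> infdist x (S n)"
      using ne[of n] by (intro infdist_greatest) (auto simp: not_less)
    then show False
      by (simp add: field_simps)
  qed
  then obtain u where u: "\<And>n. u n \<in> S n"
    "\<And>n. dist x (u n) < infdist x (S n) + inverse (real (Suc n))"
    by metis
  have "(\<lambda>n. dist (u n) x) \<longlonglongrightarrow> 0"
  proof (rule Lim_null_comparison)
    show "(\<lambda>n. infdist x (S n) + inverse (real (Suc n))) \<longlonglongrightarrow> 0"
      using tendsto_add[OF lim LIMSEQ_inverse_real_of_nat] by simp
    show "\<forall>\<^sub>F n in sequentially. norm (dist (u n) x) \<le> infdist x (S n) + inverse (real (Suc n))"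
      using u(2) by (simp add: dist_commute less_imp_le)
  qed
  then have "u \<longlonglongrightarrow> x"
    using tendsto_dist_iff by blast
  then show "x \<in> strong_lim S"
    using u(1) by (auto simp: strong_lim_def)
qed

text \<open>The distance functions are 1-Lipschitz uniformly in \<open>n\<close>, so convergence to
  zero at a nearby \<open>y\<close> gives smallness at \<open>x\<close>.\<close>

lemma closed_strong_lim:
  assumes ne: "\<And>n. S n \<noteq> {}"
  shows "closed (strong_lim S)"
proof (unfold closed_limpt islimpt_approachable, intro allI impI)
  fix x
  assume appr: "\<forall>e>0. \<exists>y\<in>strong_lim S. y \<noteq> x \<and> dist y x < e"
  have "(\<lambda>n. infdist x (S n)) \<longlonglongrightarrow> 0"
  proof (rule LIMSEQ_I)
    fix e :: real
    assume "e > 0"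
    then obtain y where y: "y \<in> strong_lim S" "dist y x < e / 2"
      using appr half_gt_zero by blast
    obtain N where "\<And>n. n \<ge> N \<Longrightarrow> infdist y (S n) < e / 2"
      using LIMSEQ_D[OF strong_lim_iff_infdist[THEN iffD1, OF ne y(1)], of "e / 2"] \<open>e > 0\<close>
      by (auto simp: infdist_nonneg)
    then have "\<And>n. n \<ge> N \<Longrightarrow> infdist x (S n) < e"
      using y(2) infdist_triangle[of x _ y] by (smt (verit) dist_commute field_sum_of_halves)
    then show "\<exists>N. \<forall>n\<ge>N. norm (infdist x (S n) - 0) < e"
      by (auto simp: infdist_nonneg)
  qed
  then show "x \<in> strong_lim S"
    using strong_lim_iff_infdist ne by blast
qed

lemma subspace_strong_lim:
  assumes S: "\<And>n. subspace (S n)"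
  shows "subspace (strong_lim S)"
proof (rule subspaceI)
  show "0 \<in> strong_lim S"
    using subspace_0[OF S] by (auto simp: strong_lim_def intro!: exI[of _ "\<lambda>_. 0"])
next
  fix x y
  assume "x \<in> strong_lim S" "y \<in> strong_lim S"
  then obtain u v where "\<forall>n. u n \<in> S n" "u \<longlonglongrightarrow> x" "\<forall>n. v n \<in> S n" "v \<longlonglongrightarrow> y"
    by (auto simp: strong_lim_def)
  then show "x + y \<in> strong_lim S"
    using subspace_add[OF S]
    by (auto simp: strong_lim_def intro!: exI[of _ "\<lambda>n. u n + v n"] tendsto_add)
next
  fix c x
  assume "x \<in> strong_lim S"
  then obtain u where "\<forall>n. u n \<in> S n" "u \<longlonglongrightarrow> x"
    by (auto simp: strong_lim_def)
  then show "c *\<^sub>R x \<in> strong_lim S"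
    using subspace_scale[OF S]
    by (auto simp: strong_lim_def intro!: exI[of _ "\<lambda>n. c *\<^sub>R u n"] tendsto_scaleR)
qed

section \<open>Inf-sup stable approximation\<close>

text \<open>The condition \<open>K \<ge> 0\<close> covers an empty unit sphere, where
  \<open>unit_sup\<close> has the value 0.\<close>

lemma unit_sup_le:
  assumes "K \<ge> 0" and "\<And>y. y \<in> S \<Longrightarrow> f y \<le> K * norm y"
  shows "unit_sup S f \<le> K"
  using assms by (fastforce simp: unit_sup_def intro!: cSUP_least)

text \<open>Continuity at the origin bounds \<open>b\<close> by 1 on pairs of norm at most
  \<open>e\<close>; rescaling both arguments to norm \<open>e\<close> yields the constant
  \<open>1 / e\<^sup>2\<close>.\<close>

lemma continuous_bilinear_imp_bounded_bilinear:
  fixes b :: "'a::real_normed_vector \<Rightarrow> 'b::real_normed_vector \<Rightarrow> 'c::real_normed_vector"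
  assumes b: "bilinear b" and cont: "continuous_on UNIV (\<lambda>(x, y). b x y)"
  shows "bounded_bilinear b"
proof -
  have lin: "linear (\<lambda>x. b x y)" "linear (b x)" for x y
    using b by (auto simp: bilinear_def)
  have zero: "b 0 y = 0" "b x 0 = 0" for x y
    using linear_0[OF lin(1)] linear_0[OF lin(2)] by auto
  have "isCont (\<lambda>(x, y). b x y) (0, 0)"
    using cont by (simp add: continuous_on_eq_continuous_at)
  then obtain d where d: "d > 0"
    "\<And>z. dist z (0, 0) < d \<Longrightarrow> norm ((\<lambda>(x, y). b x y) z) < 1"
    unfolding continuous_at_eps_delta
    by (metis (no_types, lifting) case_prod_conv dist_0_norm dist_commute zero(1) zero_less_one)
  \<comment> \<open>With a third of \<open>d\<close>, the pair has norm at most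
    \<open>2 * e\<close>, strictly below \<open>d\<close>.\<close>
  define e where "e = d / 3"
  have e: "e > 0"
    using d(1) by (simp add: e_def)
  have small: "norm (b x y) \<le> 1" if "norm x \<le> e" "norm y \<le> e" for x y
  proof -
    have "norm (x, y) \<le> norm x + norm y"
      by (rule norm_Pair_le)
    then show ?thesis
      using d(2)[of "(x, y)"] that e by (simp add: e_def dist_norm)
  qed
  have "norm (b x y) \<le> norm x * norm y * (1 / e\<^sup>2)" for x y
  proof (cases "x = 0 \<or> y = 0")
    case False
    have "norm (b ((e / norm x) *\<^sub>R x) ((e / norm y) *\<^sub>R y)) \<le> 1"
      using e by (intro small) auto
    then have "(e / norm x) * (e / norm y) * norm (b x y) \<le> 1"
      using e by (simp add: linear_scale[OF lin(1)] linear_scale[OF lin(2)] mult_ac)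
    then show ?thesis
      using False e by (simp add: field_simps power2_eq_square)
  qed (auto simp: zero)
  then show ?thesis
    using linear_add[OF lin(1)] linear_add[OF lin(2)] linear_scale[OF lin(1)] linear_scale[OF lin(2)]
    by unfold_locales blast+
qed

locale infsup_stable = b: bounded_bilinear b
  for b :: "'z::real_normed_vector \<Rightarrow> 'y::real_normed_vector \<Rightarrow> real" +
  fixes Xs :: "nat \<Rightarrow> 'z set" and Ys :: "nat \<Rightarrow> 'y set" and \<beta> :: real
  assumes Xs: "\<And>n. finite_dim_subspace (Xs n)" and Ys: "\<And>n. finite_dim_subspace (Ys n)"
    and dims: "\<And>n. dim (Xs n) = dim (Ys n)"
    and \<beta>: "\<beta> > 0"
    and infsup: "\<And>n x. x \<in> Xs n \<Longrightarrow> unit_sup (Ys n) (b x) \<ge> \<beta> * norm x"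
begin

lemma bilinear_b: "bilinear b"
  by (simp add: bilinear_def b.bounded_linear_left b.bounded_linear_right bounded_linear.linear)

lemma bilinear_flip_b: "bilinear (\<lambda>y x. b x y)"
  using bilinear_b by (simp add: bilinear_def)

lemma subspace_Xs: "subspace (Xs n)"
  using Xs by (simp add: finite_dim_subspace_def)

text \<open>The form in which stability is applied: a bound for \<open>b x\<close> tested on
  \<open>Ys n\<close> alone controls the norm of \<open>x\<close>.\<close>

lemma infsup_le:
  assumes "x \<in> Xs n" "K \<ge> 0" "\<And>y. y \<in> Ys n \<Longrightarrow> b x y \<le> K * norm y"
  shows "\<beta> * norm x \<le> K"
  using infsup[OF assms(1)] unit_sup_le[OF assms(2,3)] by fastforce

lemma nondegenerate:
  assumes "x \<in> Xs n" "\<forall>y\<in>Ys n. b x y = 0"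
  shows "x = 0"
proof -
  have "\<beta> * norm x \<le> 0"
    using assms by (intro infsup_le[where n = n]) auto
  with \<beta> show ?thesis
    by (simp add: mult_le_0_iff)
qed

lemma discrete_solution_ex1:
  fixes L :: "'y \<Rightarrow>\<^sub>L real"
  shows "\<exists>!x. x \<in> Xs n \<and> (\<forall>y\<in>Ys n. b x y = L y)"
proof -
  have "\<exists>x\<in>Xs n. \<forall>y\<in>Ys n. b x y = L y"
    by (intro pairing_represents[OF bilinear_b Xs Ys dims nondegenerate])
       (auto intro: bounded_linear.linear[OF blinfun.bounded_linear_right])
  moreover have "x = x'" if "x \<in> Xs n" "x' \<in> Xs n" "\<forall>y\<in>Ys n. b x y = b x' y" for x x'
    using nondegenerate[of "x - x'" n] subspace_diff[OF subspace_Xs that(1,2)] that(3)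
    by (simp add: b.diff_left)
  ultimately show ?thesis
    by (metis (no_types, lifting))
qed

text \<open>The functional to be represented on \<open>Xs n\<close> is
  \<open>\<lambda>x. b x y\<close>, with the two spaces exchanging roles in the pairing.\<close>

lemma transposed_discrete_solution:
  "\<exists>y'\<in>Ys n. \<forall>x\<in>Xs n. b x y' = b x y"
  by (rule pairing_represents[OF bilinear_flip_b Ys Xs dims[symmetric]])
     (use pairing_nondegenerate_right[OF bilinear_b Xs Ys dims nondegenerate] in
       \<open>auto intro: bounded_linear.linear[OF b.bounded_linear_left]\<close>)

section \<open>The operator into the dual and passage to the limit\<close>

definition form_op :: "'z \<Rightarrow> 'y \<Rightarrow>\<^sub>L real" where
  "form_op x = Blinfun (b x)"

lemma form_op_apply: "blinfun_apply (form_op x) y = b x y"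
  by (simp add: form_op_def bounded_linear_Blinfun_apply b.bounded_linear_right)

lemma bounded_linear_form_op: "bounded_linear form_op"
proof -
  obtain K where K: "\<And>x y. norm (b x y) \<le> norm x * norm y * K" "K \<ge> 0"
    using b.nonneg_bounded by blast
  show ?thesis
  proof (rule bounded_linear_intro[where K = K])
    show "norm (form_op x) \<le> norm x * K" for x
      using K by (intro norm_blinfun_bound) (auto simp: form_op_apply mult_ac)
  qed (auto intro!: blinfun_eqI simp: form_op_apply b.add_left b.scaleR_left blinfun.add_left
        blinfun.scaleR_left)
qed

text \<open>For elements of \<open>Xs n\<close> the dual norm dominates the supremum over
  \<open>Ys n\<close>, so the bound holds with the same \<open>\<beta>\<close> for every
  \<open>n\<close> and passes to limits.\<close>

lemma form_op_bounded_below: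
  assumes "x \<in> strong_lim Xs"
  shows "\<beta> * norm x \<le> norm (form_op x)"
proof -
  obtain u where u: "\<And>n. u n \<in> Xs n" "u \<longlonglongrightarrow> x"
    using assms by (auto simp: strong_lim_def)
  have "b (u n) y \<le> norm (form_op (u n)) * norm y" for n y
    using norm_blinfun[of "form_op (u n)" y] by (simp add: form_op_apply)
  then have "\<beta> * norm (u n) \<le> norm (form_op (u n))" for n
    by (intro infsup_le[where n = n] u) auto
  moreover have "(\<lambda>n. \<beta> * norm (u n)) \<longlonglongrightarrow> \<beta> * norm x"
    "(\<lambda>n. norm (form_op (u n))) \<longlonglongrightarrow> norm (form_op x)"
    using u(2) by (auto intro!: tendsto_intros bounded_linear.tendsto[OF bounded_linear_form_op])
  ultimately show ?thesis
    by (meson LIMSEQ_le)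
qed

lemma solution_unique:
  assumes "x \<in> strong_lim Xs" "x' \<in> strong_lim Xs" "\<And>y. b x y = b x' y"
  shows "x = x'"
proof -
  have "form_op (x - x') = 0"
    using assms(3) by (intro blinfun_eqI) (simp add: form_op_apply b.diff_left)
  then have "\<beta> * norm (x - x') \<le> 0"
    using form_op_bounded_below[OF subspace_diff[OF subspace_strong_lim[OF subspace_Xs] assms(1,2)]]
    by simp
  with \<beta> show ?thesis
    by (simp add: mult_le_0_iff)
qed

lemma discrete_solutions_converge:
  fixes L :: "'y \<Rightarrow>\<^sub>L real"
  assumes x: "x \<in> strong_lim Xs" "\<And>y. b x y = L y"
    and u: "\<And>n. u n \<in> Xs n" "\<And>n y. y \<in> Ys n \<Longrightarrow> b (u n) y = L y"
  shows "u \<longlonglongrightarrow> x"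
proof -
  obtain w where w: "\<And>n. w n \<in> Xs n" "w \<longlonglongrightarrow> x"
    using x(1) by (auto simp: strong_lim_def)
  have "norm (u n - w n) \<le> norm (form_op (x - w n)) / \<beta>" for n
  proof -
    \<comment> \<open>For \<open>y\<close> in \<open>Ys n\<close>, both \<open>x\<close> and
      \<open>u n\<close> give the value \<open>L y\<close>, so \<open>u n\<close> may be replaced by
      \<open>x\<close> on the left. The discrete error is thereby bounded by the approximation error
      \<open>x - w n\<close>.\<close>
    have "b (u n - w n) y \<le> norm (form_op (x - w n)) * norm y" if "y \<in> Ys n" for y
      using norm_blinfun[of "form_op (x - w n)" y] u(2)[OF that] x(2)[of y]
      by (simp add: form_op_apply b.diff_left)
    then have "\<beta> * norm (u n - w n) \<le> norm (form_op (x - w n))"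
      by (intro infsup_le[where n = n] subspace_diff[OF subspace_Xs] u w) auto
    then show ?thesis
      using \<beta> by (simp add: field_simps)
  qed
  moreover have "(\<lambda>n. form_op (x - w n)) \<longlonglongrightarrow> form_op (x - x)"
    by (intro bounded_linear.tendsto[OF bounded_linear_form_op] tendsto_intros w(2))
  then have "(\<lambda>n. norm (form_op (x - w n)) / \<beta>) \<longlonglongrightarrow> 0"
    using linear_0[OF bounded_linear.linear[OF bounded_linear_form_op]]
    by (simp add: tendsto_norm_zero tendsto_divide_zero)
  ultimately have "(\<lambda>n. u n - w n) \<longlonglongrightarrow> 0"
    by (rule Lim_null_comparison[OF always_eventually[OF allI]])
  from tendsto_add[OF this w(2)] show ?thesis
    by simp
qed

lemma weak_lim_eq_UNIV:
  assumes solvable: "\<And>L :: 'y \<Rightarrow>\<^sub>L real. \<exists>x\<in>strong_lim Xs. \<forall>y. b x y = L y"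
  shows "weak_lim Ys = UNIV"
proof -
  have "y \<in> weak_lim Ys" for y
  proof -
    \<comment> \<open>The sequence \<open>v\<close> is fixed before \<open>L\<close>, so a single
      sequence serves all functionals, as weak convergence demands.\<close>
    obtain v where v: "\<And>n. v n \<in> Ys n" "\<And>n x. x \<in> Xs n \<Longrightarrow> b x (v n) = b x y"
      using transposed_discrete_solution[of _ y] by metis
    have "(\<lambda>n. L (v n)) \<longlonglongrightarrow> L y" for L :: "'y \<Rightarrow>\<^sub>L real"
    proof -
      obtain x where x: "x \<in> strong_lim Xs" "\<And>y. b x y = L y"
        using solvable by blast
      obtain u where u: "\<And>n. u n \<in> Xs n" "\<And>n y. y \<in> Ys n \<Longrightarrow> b (u n) y = L y"
        using discrete_solution_ex1[of _ L] by metis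
      have "(\<lambda>n. b (u n) y) \<longlonglongrightarrow> b x y"
        using discrete_solutions_converge[OF x u] by (intro b.tendsto tendsto_const)
      \<comment> \<open>Each discrete solution is a test vector for the other problem, so both sides
        equal \<open>b (u n) (v n)\<close>.\<close>
      moreover have "b (u n) y = L (v n)" for n
        using u(2)[OF v(1)] v(2)[OF u(1)] by simp
      ultimately show ?thesis
        using x(2) by simp
    qed
    with v(1) show ?thesis
      by (auto simp: weak_lim_def weakly_converges_def)
  qed
  then show ?thesis
    by blast
qed

end

theorem theorem2p12:
  fixes b :: "'z::banach \<Rightarrow> 'y::banach \<Rightarrow> real"
    and Xs :: "nat \<Rightarrow> 'z set" and Ys :: "nat \<Rightarrow> 'y set"
    and X :: "'z set" and \<beta> :: real
  assumes "reflexive_space TYPE('y)"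
    and "bilinear b" and "continuous_on UNIV (\<lambda>(x, y). b x y)"
    and "\<And>n. finite_dim_subspace (Xs n)" and "\<And>n. finite_dim_subspace (Ys n)"
    and "\<And>n. dim (Xs n) = dim (Ys n)"
    and "\<beta> > 0"
    and "\<And>n x. x \<in> Xs n \<Longrightarrow> unit_sup (Ys n) (b x) \<ge> \<beta> * norm x"
    and "subspace X" and "closedin (top_of_set (strong_lim Xs)) X"
    and "\<And>y. (\<forall>x\<in>X. b x y = 0) \<Longrightarrow> y = 0"
  shows "X = strong_lim Xs \<and>
    (\<forall>L :: 'y \<Rightarrow>\<^sub>L real.
       (\<exists>!xh. xh \<in> X \<and> (\<forall>y. b xh y = blinfun_apply L y)) \<and>
       (\<forall>n. \<exists>!x. x \<in> Xs n \<and> (\<forall>y\<in>Ys n. b x y = blinfun_apply L y)) \<and>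
       (\<forall>xh u. xh \<in> X \<and> (\<forall>y. b xh y = blinfun_apply L y) \<and>
               (\<forall>n. u n \<in> Xs n \<and> (\<forall>y\<in>Ys n. b (u n) y = blinfun_apply L y))
               \<longrightarrow> u \<longlonglongrightarrow> xh)) \<and>
    weak_lim Ys = UNIV"
proof -
  interpret infsup_stable b Xs Ys \<beta>
    using continuous_bilinear_imp_bounded_bilinear[OF assms(2,3)] assms(4-8)
    by (intro infsup_stable.intro infsup_stable_axioms.intro)
  have sub: "X \<subseteq> strong_lim Xs"
    using closedin_subset[OF assms(10)] by simp
  have "Xs n \<noteq> {}" for n
    using subspace_0[OF subspace_Xs] by blast
  then have "closed X"
    using closedin_closed_trans[OF assms(10)] closed_strong_lim by blast
  \<comment> \<open>A closed subset of the Banach space is complete, and a bounded linear map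
    bounded below on a subspace carries completeness to the image.\<close>
  then have "closed (form_op ` X)"
    using complete_isometric_image[OF assms(7,9) bounded_linear_form_op] form_op_bounded_below sub
    by (auto simp: complete_eq_closed)
  moreover have "subspace (form_op ` X)"
    using assms(9) bounded_linear_form_op by (simp add: bounded_linear.linear linear_subspace_image)
  ultimately have "form_op ` X = UNIV"
    using assms(1,11) by (intro reflexive_dual_subspace_eq_UNIV) (auto simp: form_op_apply)
  then have solvable: "\<exists>x\<in>X. \<forall>y. b x y = L y" for L :: "'y \<Rightarrow>\<^sub>L real"
    by (metis UNIV_I image_iff form_op_apply)
  have "strong_lim Xs \<subseteq> X"
  proof
    fix x
    assume x: "x \<in> strong_lim Xs"
    \<comment> \<open>Solving within \<open>X\<close> for the datum \<open>form_op x\<close> gives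
      an \<open>x'\<close> that uniqueness on the larger space identifies with
      \<open>x\<close>.\<close>
    obtain x' where "x' \<in> X" "\<And>y. b x' y = form_op x y"
      using solvable by blast
    with x sub show "x \<in> X"
      using solution_unique[of x x'] by (auto simp: form_op_apply)
  qed
  with sub have eq: "X = strong_lim Xs"
    by blast
  show ?thesis
  proof (intro conjI allI impI)
    fix L :: "'y \<Rightarrow>\<^sub>L real"
    show "\<exists>!xh. xh \<in> X \<and> (\<forall>y. b xh y = L y)"
      using solvable[of L] solution_unique eq by (metis (no_types, lifting))
    show "\<exists>!x. x \<in> Xs n \<and> (\<forall>y\<in>Ys n. b x y = L y)" for n
      by (rule discrete_solution_ex1)
    show "u \<longlonglongrightarrow> xh" if "xh \<in> X \<and> (\<forall>y. b xh y = L y) \<and>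
      (\<forall>n. u n \<in> Xs n \<and> (\<forall>y\<in>Ys n. b (u n) y = L y))" for xh u
      using that eq by (intro discrete_solutions_converge[of xh L u]) auto
    show "weak_lim Ys = UNIV"
      using solvable eq by (intro weak_lim_eq_UNIV) auto
  qed (rule eq)
qed

end
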